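(* Let $(E,Q,\hat c,\delta,\Gamma)$ be any instance of a multi-objective cardinality-constrained uncertain combinatorial optimization problem. For each $l\in L:=\{1,\dots,|E|+1\}^k$ let $OPT^l$ be any complete set of efficient solutions of $\mathcal{GMP}(l)$, and let $A:=\bigcup_{l\in L}OPT^l$. Then the general algorithm DSA, which returns $$\{q\in A:\ \text{there is no } q'\in A \text{ such that } z^{R}(q') \text{ dominates } z^{R}(q)\},$$ finds a complete set of robust efficient solutions of the instance, i.e. this returned set is a complete set of robust efficient solutions.
   Context: Vectors: for $y^1,y^2\in\mathbb R^k$, $y^1$ dominates $y^2$ if $y^1_i\le y^2_i$ for all $i$ and $y^1\ne y^2$. For a multi-objective problem $\min_{x\in X}f(x)$ with $f:X\to\mathbb R^k$, $x'$ dominates $x$ if $f(x')$ dominates $f(x)$; $x\in X$ is efficient if no $x'\in X$ dominates it; two efficient solutions $x,x'$ are equivalent if $f(x)=f(x')$; a set $\bar X\subseteq X$ of efficient solutions is complete if every $x\in X\setminus\bar X$ is dominated by or equivalent to some $x'\in\bar X$. Instance: $E$ is a finite set, $Q\subseteq 2^E$ the set of feasible solutions, $k\ge2$ the number of objectives; for $e\in E$, $i\in\{1,\dots,k\}$ there are a nominal cost $\hat c_{e,i}\in\mathbb R$ and an interval length $\delta_{e,i}\ge0$; $\Gamma=(\Gamma_1,\dots,\Gamma_k)$ with integers $0\le\Gamma_i\le|E|$. The cardinality-constrained uncertainty set is $$\mathcal U=\{c\in\mathbb R^{|E|\times k}: c_{e,i}\in[\hat c_{e,i},\hat c_{e,i}+\delta_{e,i}]\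 \forall e,i;\ |\{e: c_{e,i}>\hat c_{e,i}\}|\le\Gamma_i\ \forall i\}.$$ For $q\in Q$, $z^R(q)=(z^R_1(q),\dots,z^R_k(q))$ with $z^R_i(q)=\max_{c\in\mathcal U}\sum_{e\in q}c_{e,i}$. Robust efficient means efficient for $\min_{q\in Q}z^R(q)$; a complete set of robust efficient solutions is a complete set of efficient solutions for this problem. For each objective $i$, sort $E$ in descending order of $\delta_{e,i}$ and let $E^i_j$ be the set of the first $j$ elements in this order ($j=1,\dots,|E|$), and $E^i_{|E|+1}:=E$. Put $\bar\delta^i_j:=\min_{e\in E^i_j}\delta_{e,i}$ for $j\le|E|$ and $\bar\delta^i_{|E|+1}:=0$. For $l=(l_1,\dots,l_k)\in\{1,\dots,|E|+1\}^k$, $\mathcal{GMP}(l)$ is the deterministic multi-objective problem $\min_{q\in Q}g^l(q)$ with components $$g^l_i(q):=\sum_{e\in q}\hat c_{e,i}+\Gamma_i\cdot\bar\delta^i_{l_i}+\sum_{e\in q\cap E^i_{l_i}}(\delta_{e,i}-\bar\delta^i_{l_i}),\quad i=1,\dots,k.$$ *)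

theory Defs
  imports "HOL-Analysis.Finite_Cartesian_Product"
begin

text \<open>The objectives are indexed by a finite type \<open>'k\<close>, so that \<open>k = CARD('k)\<close>.\<close>

definition dominates :: "real ^ 'k \<Rightarrow> real ^ 'k \<Rightarrow> bool" where
  "dominates y1 y2 \<longleftrightarrow> (\<forall>i. y1 $ i \<le> y2 $ i) \<and> y1 \<noteq> y2"

definition efficient :: "'x set \<Rightarrow> ('x \<Rightarrow> real ^ 'k) \<Rightarrow> 'x \<Rightarrow> bool" where
  "efficient X f x \<longleftrightarrow> x \<in> X \<and> \<not> (\<exists>x'\<in>X. dominates (f x') (f x))"

definition equivalent :: "'x set \<Rightarrow> ('x \<Rightarrow> real ^ 'k) \<Rightarrow> 'x \<Rightarrow> 'x \<Rightarrow> bool" where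
  "equivalent X f x x' \<longleftrightarrow> efficient X f x \<and> efficient X f x' \<and> f x = f x'"

definition complete_efficient_set :: "'x set \<Rightarrow> ('x \<Rightarrow> real ^ 'k) \<Rightarrow> 'x set \<Rightarrow> bool" where
  "complete_efficient_set X f X' \<longleftrightarrow>
     X' \<subseteq> {x. efficient X f x} \<and>
     (\<forall>x \<in> X - X'. \<exists>x'\<in>X'. dominates (f x') (f x) \<or> equivalent X f x x')"

text \<open>Cost matrices indexed by \<open>E \<times> 'k\<close> are functions that are extensional on \<open>E\<close>.\<close>

definition uncertainty_set ::
  "'e set \<Rightarrow> ('e \<Rightarrow> real ^ 'k) \<Rightarrow> ('e \<Rightarrow> real ^ 'k) \<Rightarrow> ('k \<Rightarrow> nat) \<Rightarrow> ('e \<Rightarrow> real ^ 'k) set" where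
  "uncertainty_set E chat \<delta> \<Gamma> =
     {c \<in> extensional E.
        (\<forall>e\<in>E. \<forall>i. c e $ i \<in> {chat e $ i .. chat e $ i + \<delta> e $ i}) \<and>
        (\<forall>i. card {e \<in> E. c e $ i > chat e $ i} \<le> \<Gamma> i)}"

text \<open>\<open>GREATEST\<close> rather than \<open>Max\<close>, because the set of attainable values is infinite in general.\<close>

definition robust_cost ::
  "'e set \<Rightarrow> ('e \<Rightarrow> real ^ 'k) \<Rightarrow> ('e \<Rightarrow> real ^ 'k) \<Rightarrow> ('k \<Rightarrow> nat) \<Rightarrow> 'e set \<Rightarrow> real ^ 'k" where
  "robust_cost E chat \<delta> \<Gamma> q =
     (\<chi> i. GREATEST v. \<exists>c \<in> uncertainty_set E chat \<delta> \<Gamma>. v = (\<Sum>e\<in>q. c e $ i))"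

text \<open>An enumeration of \<open>E\<close> in descending order of the interval lengths for objective \<open>i\<close>;
  ties may be broken arbitrarily, so the list is not determined by \<open>\<delta>\<close>.\<close>

definition descending_enum :: "'e set \<Rightarrow> ('e \<Rightarrow> real ^ 'k) \<Rightarrow> 'k \<Rightarrow> 'e list \<Rightarrow> bool" where
  "descending_enum E \<delta> i es \<longleftrightarrow>
     distinct es \<and> set es = E \<and> sorted_wrt (\<lambda>e e'. \<delta> e $ i \<ge> \<delta> e' $ i) es"

definition first_elems :: "'e set \<Rightarrow> ('k \<Rightarrow> 'e list) \<Rightarrow> 'k \<Rightarrow> nat \<Rightarrow> 'e set" where
  "first_elems E ord i j = (if j \<le> card E then set (take j (ord i)) else E)"

definition delta_bar ::
  "'e set \<Rightarrow> ('e \<Rightarrow> real ^ 'k) \<Rightarrow> ('k \<Rightarrow> 'e list) \<Rightarrow> 'k \<Rightarrow> nat \<Rightarrow> real" where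
  "delta_bar E \<delta> ord i j =
     (if j \<le> card E then Min ((\<lambda>e. \<delta> e $ i) ` first_elems E ord i j) else 0)"

definition gmp_cost ::
  "'e set \<Rightarrow> ('e \<Rightarrow> real ^ 'k) \<Rightarrow> ('e \<Rightarrow> real ^ 'k) \<Rightarrow> ('k \<Rightarrow> nat) \<Rightarrow> ('k \<Rightarrow> 'e list) \<Rightarrow>
   ('k \<Rightarrow> nat) \<Rightarrow> 'e set \<Rightarrow> real ^ 'k" where
  "gmp_cost E chat \<delta> \<Gamma> ord l q =
     (\<chi> i. (\<Sum>e\<in>q. chat e $ i) + real (\<Gamma> i) * delta_bar E \<delta> ord i (l i)
          + (\<Sum>e \<in> q \<inter> first_elems E ord i (l i). \<delta> e $ i - delta_bar E \<delta> ord i (l i)))"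

definition index_set :: "'e set \<Rightarrow> ('k \<Rightarrow> nat) set" where
  "index_set E = {l. \<forall>i. l i \<in> {1 .. card E + 1}}"

definition dsa_output ::
  "'e set \<Rightarrow> ('e \<Rightarrow> real ^ 'k) \<Rightarrow> ('e \<Rightarrow> real ^ 'k) \<Rightarrow> ('k \<Rightarrow> nat) \<Rightarrow>
   (('k \<Rightarrow> nat) \<Rightarrow> 'e set set) \<Rightarrow> 'e set set" where
  "dsa_output E chat \<delta> \<Gamma> OPT =
     (let A = \<Union>l \<in> index_set E. OPT l
      in {q \<in> A. \<not> (\<exists>q'\<in>A. dominates (robust_cost E chat \<delta> \<Gamma> q') (robust_cost E chat \<delta> \<Gamma> q))})"

end

theory Submission
  imports Defs
begin

text \<open>
  The heart of the matter is that, for each objective separately,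
  \<^term>\<open>robust_cost E chat \<delta> \<Gamma> q $ i\<close> is the minimum over \<open>j \<in> {1..card E + 1}\<close> of the
  \<open>i\<close>-th \<open>\<G>\<M>\<P>\<close> cost with \<open>l i = j\<close>. An adversary who may raise at most \<open>\<Gamma> i\<close> costs gains the
  sum of the \<open>\<Gamma> i\<close> largest interval lengths in \<open>q\<close>; bounding every length by a threshold
  \<open>\<delta>bar\<close> plus its excess over the threshold shows that each \<open>\<G>\<M>\<P>\<close> cost is an upper bound
  (\<open>scenario_cost_le_gmp_cost\<close>), and taking the \<open>(\<Gamma> i + 1)\<close>-st largest length in \<open>q\<close> as the
  threshold makes the bound tight (\<open>gmp_cost_attained\<close>).

  Since the indices \<open>l i\<close> can be chosen independently, every solution \<open>q\<close> has one index vector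
  \<open>l\<close> at which all components of the \<open>\<G>\<M>\<P>\<close> cost equal those of the robust cost. A complete set
  for that problem contains some \<open>a\<close> that is at least as good as \<open>q\<close> there, and as the robust cost
  lies below every \<open>\<G>\<M>\<P>\<close> cost, \<open>a\<close> is also at least as good as \<open>q\<close> in robust cost. So the
  union \<open>A\<close> of the complete sets contains, for each feasible solution, one whose robust cost is
  componentwise at most as large; filtering out the dominated members of any finite set with this
  property leaves a complete set (\<open>nondominated_of_covering_is_complete\<close>).
\<close>

section \<open>Complete sets from covering sets\<close>

lemma dominates_less_iff:
  "dominates y1 y2 \<longleftrightarrow> (\<forall>i. y1 $ i \<le> y2 $ i) \<and> (\<exists>i. y1 $ i < y2 $ i)"
  unfolding dominates_def vec_eq_iff by (metis less_le)

lemma le_dominates_trans: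
  assumes "\<And>i. y1 $ i \<le> y2 $ i" and "dominates y2 y3"
  shows "dominates y1 y3"
proof -
  obtain i where "y2 $ i < y3 $ i" using assms(2) unfolding dominates_less_iff by blast
  with assms(1) have "y1 $ i < y3 $ i" by (rule le_less_trans)
  then show ?thesis using assms unfolding dominates_less_iff by (meson order_trans)
qed

lemma ex_nondominated_below:
  fixes f :: "'x \<Rightarrow> real ^ 'k"
  assumes "finite A" and "a \<in> A"
  obtains m where "m \<in> A" "\<And>i. f m $ i \<le> f a $ i" "\<not> (\<exists>x\<in>A. dominates (f x) (f m))"
proof -
  define B where "B = {x \<in> A. \<forall>i. f x $ i \<le> f a $ i}"
  \<comment> \<open>Domination strictly decreases the sum of the components, so a minimiser of that sum
    over the elements below \<open>a\<close> is nondominated.\<close>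
  define s where "s x = (\<Sum>i\<in>UNIV. f x $ i)" for x
  have "finite B" "B \<noteq> {}" using assms by (auto simp: B_def)
  then obtain m where m: "m \<in> B" "\<And>x. x \<in> B \<Longrightarrow> s m \<le> s x"
    by (metis arg_min_if_finite(1) arg_min_least)
  have "\<not> dominates (f x) (f m)" if "x \<in> A" for x
  proof
    assume d: "dominates (f x) (f m)"
    have "x \<in> B"
      using d that m(1) unfolding B_def dominates_def by (auto intro: order_trans)
    moreover have "s x < s m"
      unfolding s_def
    proof (rule sum_strict_mono_ex1)
      show "\<exists>i\<in>UNIV. f x $ i < f m $ i"
        using d by (simp add: dominates_less_iff)
    qed (use d in \<open>auto simp: dominates_def\<close>)
    ultimately show False using m(2) by fastforce
  qed
  with m(1) show ?thesis by (intro that[of m]) (auto simp: B_def)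
qed

text \<open>Whatever dominates a member of the filtered set could be replaced by an element of \<open>A\<close>, by
  covering, so being nondominated within \<open>A\<close> already means being efficient in \<open>X\<close>. Finiteness
  of \<open>A\<close> provides, below every element of \<open>X\<close>, a member that survives the filter.\<close>

lemma nondominated_of_covering_is_complete:
  fixes f :: "'x \<Rightarrow> real ^ 'k"
  assumes fin: "finite A" and sub: "A \<subseteq> X"
    and cover: "\<And>x. x \<in> X \<Longrightarrow> \<exists>a\<in>A. \<forall>i. f a $ i \<le> f x $ i"
  shows "complete_efficient_set X f {x \<in> A. \<not> (\<exists>x'\<in>A. dominates (f x') (f x))}"
    (is "complete_efficient_set X f ?M")
  unfolding complete_efficient_set_def
proof (intro conjI subsetI ballI)
  fix x assume x: "x \<in> ?M"
  have "\<not> dominates (f y) (f x)" if "y \<in> X" for y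
  proof
    assume "dominates (f y) (f x)"
    moreover obtain a where "a \<in> A" "\<And>i. f a $ i \<le> f y $ i" using cover[OF \<open>y \<in> X\<close>] by blast
    ultimately show False using x le_dominates_trans by blast
  qed
  then show "x \<in> {x. efficient X f x}" using x sub by (auto simp: efficient_def)
next
  fix x assume x: "x \<in> X - ?M"
  then obtain a where a: "a \<in> A" "\<And>i. f a $ i \<le> f x $ i" using cover by blast
  obtain m where m: "m \<in> A" "\<And>i. f m $ i \<le> f a $ i" "\<not> (\<exists>x\<in>A. dominates (f x) (f m))"
    using ex_nondominated_below[OF fin a(1)] by blast
  have le: "f m $ i \<le> f x $ i" for i using a(2) m(2) order_trans by blast
  have "dominates (f m) (f x) \<or> equivalent X f x m"
  proof (cases "f m = f x")
    case False
    then show ?thesis using le by (auto simp: dominates_def)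
  next
    case True
    have "\<not> dominates (f y) (f m)" if "y \<in> X" for y
      using cover[OF that] m(3) le_dominates_trans by blast
    then show ?thesis using True x m(1) sub by (auto simp: equivalent_def efficient_def)
  qed
  then show "\<exists>x'\<in>?M. dominates (f x') (f x) \<or> equivalent X f x x'" using m by blast
qed

lemma complete_set_weakly_below:
  assumes "complete_efficient_set X f X'" and "x \<in> X"
  obtains x' where "x' \<in> X'" "\<And>i. f x' $ i \<le> f x $ i"
  using assms unfolding complete_efficient_set_def dominates_def equivalent_def
  by (metis DiffI order_refl)

section \<open>Thresholds\<close>

lemma descending_enum_length: "descending_enum E \<delta> i es \<Longrightarrow> length es = card E"
  unfolding descending_enum_def using distinct_card by force

lemma descending_enum_nth_mono:
  assumes "descending_enum E \<delta> i es" "a \<le> b" "b < length es"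
  shows "\<delta> (es ! b) $ i \<le> \<delta> (es ! a) $ i"
  using assms by (cases "a = b") (auto simp: descending_enum_def sorted_wrt_iff_nth_less)

lemma delta_bar_eq_nth:
  assumes ord: "descending_enum E \<delta> i (ord i)" and j: "1 \<le> j" "j \<le> card E"
  shows "delta_bar E \<delta> ord i j = \<delta> (ord i ! (j - 1)) $ i"
proof -
  have len: "length (ord i) = card E" using descending_enum_length[OF ord] .
  have "Min ((\<lambda>e. \<delta> e $ i) ` set (take j (ord i))) = \<delta> (ord i ! (j - 1)) $ i"
  proof (rule Min_eqI)
    fix y assume "y \<in> (\<lambda>e. \<delta> e $ i) ` set (take j (ord i))"
    then obtain m where m: "m < j" "y = \<delta> (ord i ! m) $ i"
      by (auto simp: in_set_conv_nth)
    show "\<delta> (ord i ! (j - 1)) $ i \<le> y"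
      unfolding m(2) by (rule descending_enum_nth_mono[OF ord]) (use m j len in auto)
  next
    have "ord i ! (j - 1) = take j (ord i) ! (j - 1)" using j by simp
    also have "\<dots> \<in> set (take j (ord i))" by (rule nth_mem) (use j len in auto)
    finally show "\<delta> (ord i ! (j - 1)) $ i \<in> (\<lambda>e. \<delta> e $ i) ` set (take j (ord i))" by simp
  qed simp
  then show ?thesis using j by (simp add: delta_bar_def first_elems_def)
qed

lemma delta_bar_le_first:
  assumes "descending_enum E \<delta> i (ord i)" and "\<And>e. e \<in> E \<Longrightarrow> \<delta> e $ i \<ge> 0"
    and "e \<in> first_elems E ord i j"
  shows "delta_bar E \<delta> ord i j \<le> \<delta> e $ i"
  using assms by (auto simp: delta_bar_def first_elems_def split: if_splits)

lemma le_delta_bar_rest: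
  assumes ord: "descending_enum E \<delta> i (ord i)" and j: "1 \<le> j"
    and e: "e \<in> E" "e \<notin> first_elems E ord i j"
  shows "\<delta> e $ i \<le> delta_bar E \<delta> ord i j"
proof -
  have jle: "j \<le> card E" and nt: "e \<notin> set (take j (ord i))"
    using e by (auto simp: first_elems_def split: if_splits)
  have len: "length (ord i) = card E" using descending_enum_length[OF ord] .
  obtain m where m: "m < length (ord i)" "e = ord i ! m"
    using ord e(1) unfolding descending_enum_def by (metis in_set_conv_nth)
  have "\<not> m < j"
  proof
    assume "m < j"
    then have "take j (ord i) ! m \<in> set (take j (ord i))" by (intro nth_mem) (use m in auto)
    then show False using nt m \<open>m < j\<close> by simp
  qed
  then show ?thesis
    using descending_enum_nth_mono[OF ord, of "j - 1" m] m delta_bar_eq_nth[where ord = ord and \<delta> = \<delta>, OF ord j jle] by simp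
qed

lemma delta_bar_nonneg:
  assumes ord: "descending_enum E \<delta> i (ord i)" and nonneg: "\<And>e. e \<in> E \<Longrightarrow> \<delta> e $ i \<ge> 0"
    and j: "1 \<le> j"
  shows "delta_bar E \<delta> ord i j \<ge> 0"
proof (cases "j \<le> card E")
  case True
  have "ord i ! (j - 1) \<in> set (ord i)"
    by (rule nth_mem) (use j True descending_enum_length[OF ord] in auto)
  then have "ord i ! (j - 1) \<in> E" using ord by (simp add: descending_enum_def)
  then show ?thesis using delta_bar_eq_nth[where ord = ord and \<delta> = \<delta>, OF ord j True] nonneg by simp
qed (simp add: delta_bar_def)

section \<open>The robust cost as a minimum of threshold costs\<close>

text \<open>A raised element costs at most its nominal cost plus the threshold, plus, if it is among the
  first \<open>l i\<close> elements, the nonnegative excess of its length over the threshold. At most \<open>\<Gamma> i\<close>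
  elements are raised, so the thresholds add up to at most \<open>\<Gamma> i\<close> of them; the excesses may as
  well be charged for all elements of \<open>q\<close>.\<close>

lemma scenario_cost_le_gmp_cost:
  fixes chat \<delta> :: "'e \<Rightarrow> real ^ 'k"
  assumes fin: "finite E" and q: "q \<subseteq> E"
    and ord: "descending_enum E \<delta> i (ord i)" and nonneg: "\<And>e. e \<in> E \<Longrightarrow> \<delta> e $ i \<ge> 0"
    and l: "1 \<le> l i" and c: "c \<in> uncertainty_set E chat \<delta> \<Gamma>"
  shows "(\<Sum>e\<in>q. c e $ i) \<le> gmp_cost E chat \<delta> \<Gamma> ord l q $ i"
proof -
  define d where "d = delta_bar E \<delta> ord i (l i)"
  define F where "F = first_elems E ord i (l i)"
  define R where "R = {e \<in> E. c e $ i > chat e $ i}"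
  have c_bounds: "chat e $ i \<le> c e $ i" "c e $ i \<le> chat e $ i + \<delta> e $ i" if "e \<in> E" for e
    using c that by (auto simp: uncertainty_set_def)
  have "card R \<le> \<Gamma> i" using c by (simp add: uncertainty_set_def R_def)
  have "d \<ge> 0" unfolding d_def by (rule delta_bar_nonneg[where ord = ord and \<delta> = \<delta>, OF ord nonneg l])
  have finq: "finite q" using fin q finite_subset by blast
  have "(\<Sum>e\<in>q. c e $ i) \<le>
      (\<Sum>e\<in>q. chat e $ i + (if e \<in> R then d else 0) + (if e \<in> F then \<delta> e $ i - d else 0))"
  proof (rule sum_mono)
    fix e assume "e \<in> q"
    then have e: "e \<in> E" using q by auto
    have "d \<le> \<delta> e $ i" if "e \<in> F"
      using delta_bar_le_first[where ord = ord and \<delta> = \<delta>, OF ord nonneg] that by (auto simp: d_def F_def)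
    moreover have "\<delta> e $ i \<le> d" if "e \<notin> F"
      using le_delta_bar_rest[where ord = ord and \<delta> = \<delta>, OF ord l e] that by (auto simp: d_def F_def)
    moreover have "c e $ i = chat e $ i" if "e \<notin> R"
      using that e c_bounds(1)[OF e] by (auto simp: R_def)
    ultimately show "c e $ i \<le>
        chat e $ i + (if e \<in> R then d else 0) + (if e \<in> F then \<delta> e $ i - d else 0)"
      using c_bounds[OF e] by auto
  qed
  also have "\<dots> = (\<Sum>e\<in>q. chat e $ i) + card (q \<inter> R) * d + (\<Sum>e\<in>q \<inter> F. \<delta> e $ i - d)"
    using finq by (simp add: sum.distrib sum.inter_restrict[symmetric] del: sum_subtractf)
  also have "card (q \<inter> R) * d \<le> \<Gamma> i * d"
  proof (rule mult_right_mono)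
    have "card (q \<inter> R) \<le> card R" by (rule card_mono) (use fin in \<open>auto simp: R_def\<close>)
    then show "real (card (q \<inter> R)) \<le> real (\<Gamma> i)" using \<open>card R \<le> \<Gamma> i\<close> by simp
  qed fact
  finally show ?thesis by (simp add: gmp_cost_def d_def F_def)
qed

text \<open>Raising the costs of \<open>T\<close> to their upper ends, in objective \<open>i\<close> alone, is a legitimate
  scenario as soon as \<open>T\<close> respects the cardinality bound.\<close>

lemma ex_scenario_raising:
  fixes chat \<delta> :: "'e \<Rightarrow> real ^ 'k"
  assumes fin: "finite E" and q: "q \<subseteq> E" and T: "T \<subseteq> q" "card T \<le> \<Gamma> i"
    and nonneg: "\<And>e i. e \<in> E \<Longrightarrow> \<delta> e $ i \<ge> 0"
  obtains c where "c \<in> uncertainty_set E chat \<delta> \<Gamma>"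
    "(\<Sum>e\<in>q. c e $ i) = (\<Sum>e\<in>q. chat e $ i) + (\<Sum>e\<in>T. \<delta> e $ i)"
proof -
  define c where "c = restrict
    (\<lambda>e. \<chi> j. chat e $ j + (if j = i \<and> e \<in> T then \<delta> e $ j else 0)) E"
  have c_nth: "c e $ j = chat e $ j + (if j = i \<and> e \<in> T then \<delta> e $ j else 0)" if "e \<in> E" for e j
    using that by (simp add: c_def)
  have finq: "finite q" using fin q finite_subset by blast
  have "card {e \<in> E. c e $ j > chat e $ j} \<le> \<Gamma> j" for j
  proof (cases "j = i")
    case True
    have "card {e \<in> E. c e $ i > chat e $ i} \<le> card T"
      by (rule card_mono) (use finq T(1) finite_subset in \<open>auto simp: c_nth split: if_splits\<close>)
    then show ?thesis using True T(2) by simp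
  next
    case False
    then have "{e \<in> E. c e $ j > chat e $ j} = {}" by (auto simp: c_nth)
    then show ?thesis by (simp only: card.empty)
  qed
  then have "c \<in> uncertainty_set E chat \<delta> \<Gamma>"
    using nonneg by (auto simp: uncertainty_set_def c_nth) (simp add: c_def)
  moreover have "(\<Sum>e\<in>q. c e $ i) = (\<Sum>e\<in>q. chat e $ i) + (\<Sum>e\<in>T. \<delta> e $ i)"
  proof -
    have "(\<Sum>e\<in>q. c e $ i) = (\<Sum>e\<in>q. chat e $ i + (if e \<in> T then \<delta> e $ i else 0))"
      by (rule sum.cong) (use q in \<open>auto simp: c_nth\<close>)
    also have "\<dots> = (\<Sum>e\<in>q. chat e $ i) + (\<Sum>e\<in>q \<inter> T. \<delta> e $ i)"
      using finq by (simp add: sum.distrib sum.inter_restrict)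
    also have "q \<inter> T = T" using T by auto
    finally show ?thesis .
  qed
  ultimately show ?thesis by (rule that)
qed

text \<open>If \<open>q\<close> has at most \<open>\<Gamma> i\<close> elements, all of them can be raised, which the threshold \<open>0\<close>
  accounts for. Otherwise the threshold is the length of the \<open>(\<Gamma> i + 1)\<close>-st element of \<open>q\<close> in the
  enumeration: its excess vanishes, so the excesses of the \<open>\<Gamma> i\<close> elements before it plus \<open>\<Gamma> i\<close>
  times the threshold sum to their lengths. Taking the \<open>\<Gamma> i\<close>-th element instead would need a
  separate argument for \<open>\<Gamma> i = 0\<close>.\<close>

lemma gmp_cost_attained:
  fixes chat \<delta> :: "'e \<Rightarrow> real ^ 'k"
  assumes fin: "finite E" and q: "q \<subseteq> E"
    and ord: "descending_enum E \<delta> i (ord i)" and nonneg: "\<And>e i. e \<in> E \<Longrightarrow> \<delta> e $ i \<ge> 0"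
  obtains j where "j \<in> {1..card E + 1}"
    "\<And>l. l i = j \<Longrightarrow> \<exists>c\<in>uncertainty_set E chat \<delta> \<Gamma>.
       (\<Sum>e\<in>q. c e $ i) = gmp_cost E chat \<delta> \<Gamma> ord l q $ i"
proof -
  define es where "es = ord i"
  have dist: "distinct es" and set_es: "set es = E"
    using ord by (auto simp: es_def descending_enum_def)
  have len: "length es = card E" using descending_enum_length[OF ord] by (simp add: es_def)
  show ?thesis
  proof (cases "card q \<le> \<Gamma> i")
    case True
    obtain c where c: "c \<in> uncertainty_set E chat \<delta> \<Gamma>"
      "(\<Sum>e\<in>q. c e $ i) = (\<Sum>e\<in>q. chat e $ i) + (\<Sum>e\<in>q. \<delta> e $ i)"
      using ex_scenario_raising[where T = q and chat = chat and \<delta> = \<delta> and \<Gamma> = \<Gamma>, OF fin q order_refl True nonneg] by blast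
    have "gmp_cost E chat \<delta> \<Gamma> ord l q $ i = (\<Sum>e\<in>q. chat e $ i) + (\<Sum>e\<in>q. \<delta> e $ i)"
      if "l i = card E + 1" for l
      using that q by (simp add: gmp_cost_def delta_bar_def first_elems_def Int_absorb2)
    then show ?thesis using c by (intro that[of "card E + 1"]) auto
  next
    case False
    define P where "P j \<longleftrightarrow> card (q \<inter> set (take j es)) > \<Gamma> i" for j
    define j where "j = (LEAST j. P j)"
    have Pn: "P (card E)" using False q set_es len by (simp add: P_def Int_absorb2)
    have Pj: "P j" unfolding j_def by (rule LeastI[of P, OF Pn])
    have jle: "j \<le> card E" unfolding j_def by (rule Least_le[of P, OF Pn])
    have "j \<noteq> 0" using Pj by (auto simp: P_def intro: gr0I)
    define m where "m = j - 1"
    have jm: "j = Suc m" using \<open>j \<noteq> 0\<close> by (simp add: m_def)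
    have mlt: "m < length es" using jm jle len by simp
    have notPm: "\<not> P m" using not_less_Least[of m P] jm by (simp add: j_def)
    define T where "T = q \<inter> set (take m es)"
    define x where "x = es ! m"
    have takej: "set (take j es) = insert x (set (take m es))"
      using mlt by (simp add: jm x_def take_Suc_conv_app_nth)
    have xnot: "x \<notin> T"
      using dist mlt by (auto simp: T_def x_def in_set_conv_nth nth_eq_iff_index_eq)
    have finT: "finite T" by (simp add: T_def)
    \<comment> \<open>By minimality of \<open>j\<close> the count passes \<open>\<Gamma> i\<close> exactly at \<open>x\<close>, so \<open>x\<close> lies in \<open>q\<close>.\<close>
    have "x \<in> q"
    proof (rule ccontr)
      assume "x \<notin> q"
      then have "q \<inter> set (take j es) = T" by (auto simp: takej T_def)
      then show False using Pj notPm by (simp add: P_def T_def)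
    qed
    then have qj: "q \<inter> set (take j es) = insert x T" by (auto simp: takej T_def)
    then have cardT: "card T = \<Gamma> i"
      using Pj notPm finT xnot by (simp add: P_def flip: T_def)
    have dbar: "delta_bar E \<delta> ord i j = \<delta> x $ i"
      using delta_bar_eq_nth[where ord = ord and \<delta> = \<delta>, OF ord _ jle] jm by (simp add: x_def es_def)
    have first: "q \<inter> first_elems E ord i j = insert x T"
      using qj jle by (simp add: first_elems_def es_def)
    obtain c where c: "c \<in> uncertainty_set E chat \<delta> \<Gamma>"
      "(\<Sum>e\<in>q. c e $ i) = (\<Sum>e\<in>q. chat e $ i) + (\<Sum>e\<in>T. \<delta> e $ i)"
      using ex_scenario_raising[where T = T and chat = chat and \<delta> = \<delta> and \<Gamma> = \<Gamma>, OF fin q _ _ nonneg] cardT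
      by (auto simp: T_def)
    have "gmp_cost E chat \<delta> \<Gamma> ord l q $ i = (\<Sum>e\<in>q. chat e $ i) + (\<Sum>e\<in>T. \<delta> e $ i)"
      if "l i = j" for l
      using that finT xnot cardT by (simp add: gmp_cost_def dbar first sum_subtractf algebra_simps)
    then show ?thesis using c jle jm by (intro that[of j]) auto
  qed
qed

text \<open>The tight threshold also shows that the \<open>GREATEST\<close> in the robust cost exists.\<close>

lemma robust_cost_is_min_gmp_cost:
  fixes chat \<delta> :: "'e \<Rightarrow> real ^ 'k"
  assumes fin: "finite E" and q: "q \<subseteq> E"
    and ord: "\<And>i. descending_enum E \<delta> i (ord i)" and nonneg: "\<And>e i. e \<in> E \<Longrightarrow> \<delta> e $ i \<ge> 0"
  shows robust_cost_eq_gmp_cost: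
      "\<exists>l\<in>index_set E. robust_cost E chat \<delta> \<Gamma> q = gmp_cost E chat \<delta> \<Gamma> ord l q"
    and robust_cost_le_gmp_cost:
      "l \<in> index_set E \<Longrightarrow> robust_cost E chat \<delta> \<Gamma> q $ i \<le> gmp_cost E chat \<delta> \<Gamma> ord l q $ i"
proof -
  have upper: "(\<Sum>e\<in>q. c e $ i) \<le> gmp_cost E chat \<delta> \<Gamma> ord l q $ i"
    if "l \<in> index_set E" "c \<in> uncertainty_set E chat \<delta> \<Gamma>" for l c i
    using scenario_cost_le_gmp_cost[where ord = ord and chat = chat and \<delta> = \<delta>, OF fin q ord nonneg _ that(2)] that(1)
    by (simp add: index_set_def)
  have "\<forall>i. \<exists>j. j \<in> {1..card E + 1} \<and> (\<forall>l. l i = j \<longrightarrow> (\<exists>c\<in>uncertainty_set E chat \<delta> \<Gamma>.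
       (\<Sum>e\<in>q. c e $ i) = gmp_cost E chat \<delta> \<Gamma> ord l q $ i))"
  proof
    fix i
    show "\<exists>j. j \<in> {1..card E + 1} \<and> (\<forall>l. l i = j \<longrightarrow> (\<exists>c\<in>uncertainty_set E chat \<delta> \<Gamma>.
       (\<Sum>e\<in>q. c e $ i) = gmp_cost E chat \<delta> \<Gamma> ord l q $ i))"
      by (rule gmp_cost_attained[where ord = ord and chat = chat and \<delta> = \<delta> and i = i,
            OF fin q ord nonneg]) blast+
  qed
  then obtain L where L: "\<And>i. L i \<in> {1..card E + 1}"
    and attained: "\<And>i. \<exists>c\<in>uncertainty_set E chat \<delta> \<Gamma>.
       (\<Sum>e\<in>q. c e $ i) = gmp_cost E chat \<delta> \<Gamma> ord L q $ i"
    by metis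
  have Lin: "L \<in> index_set E" using L by (simp add: index_set_def)
  have eq: "robust_cost E chat \<delta> \<Gamma> q $ i = gmp_cost E chat \<delta> \<Gamma> ord L q $ i" for i
    unfolding robust_cost_def vec_lambda_beta
    by (rule Greatest_equality) (use attained[of i] upper[OF Lin] in \<open>force+\<close>)
  show "\<exists>l\<in>index_set E. robust_cost E chat \<delta> \<Gamma> q = gmp_cost E chat \<delta> \<Gamma> ord l q"
    using Lin eq by (auto simp: vec_eq_iff)
  show "robust_cost E chat \<delta> \<Gamma> q $ i \<le> gmp_cost E chat \<delta> \<Gamma> ord l q $ i" if "l \<in> index_set E"
    using attained[of i] upper[OF that] eq by metis
qed

section \<open>Correctness of the algorithm\<close>

theorem theorem20:
  fixes E :: "'e set"
    and Q :: "'e set set"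
    and chat \<delta> :: "'e \<Rightarrow> real ^ 'k"
    and \<Gamma> :: "'k \<Rightarrow> nat"
    and ord :: "'k \<Rightarrow> 'e list"
    and OPT :: "('k \<Rightarrow> nat) \<Rightarrow> 'e set set"
  assumes "finite E"
    and "Q \<subseteq> Pow E"
    and "CARD('k) \<ge> 2"
    and "\<And>e i. e \<in> E \<Longrightarrow> \<delta> e $ i \<ge> 0"
    and "\<And>i. \<Gamma> i \<le> card E"
    and "\<And>i. descending_enum E \<delta> i (ord i)"
    and "\<And>l. l \<in> index_set E \<Longrightarrow>
           complete_efficient_set Q (gmp_cost E chat \<delta> \<Gamma> ord l) (OPT l)"
  shows "complete_efficient_set Q (robust_cost E chat \<delta> \<Gamma>) (dsa_output E chat \<delta> \<Gamma> OPT)"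
proof -
  note fin = assms(1) and Q = assms(2) and nonneg = assms(4) and ord = assms(6) and OPT = assms(7)
  let ?z = "robust_cost E chat \<delta> \<Gamma>"
  define A where "A = (\<Union>l\<in>index_set E. OPT l)"
  have sub: "A \<subseteq> Q"
    using OPT by (fastforce simp: A_def complete_efficient_set_def efficient_def)
  have "finite A"
    using sub Q fin by (meson finite_Pow_iff finite_subset)
  have "\<exists>a\<in>A. \<forall>i. ?z a $ i \<le> ?z q $ i" if "q \<in> Q" for q
  proof -
    obtain l where l: "l \<in> index_set E" "?z q = gmp_cost E chat \<delta> \<Gamma> ord l q"
      using robust_cost_eq_gmp_cost[where ord = ord and chat = chat and \<delta> = \<delta>, OF fin _ ord nonneg] \<open>q \<in> Q\<close> Q by blast
    obtain a where a: "a \<in> OPT l"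
      "\<And>i. gmp_cost E chat \<delta> \<Gamma> ord l a $ i \<le> gmp_cost E chat \<delta> \<Gamma> ord l q $ i"
      using complete_set_weakly_below[OF OPT[OF l(1)] \<open>q \<in> Q\<close>] by blast
    have "a \<in> A" using a(1) l(1) by (auto simp: A_def)
    then have "a \<subseteq> E" using sub Q by auto
    then have "?z a $ i \<le> gmp_cost E chat \<delta> \<Gamma> ord l a $ i" for i
      using robust_cost_le_gmp_cost[where ord = ord and chat = chat and \<delta> = \<delta>, OF fin _ ord nonneg l(1)] by blast
    then show ?thesis using a(2) l(2) \<open>a \<in> A\<close> order_trans by metis
  qed
  from nondominated_of_covering_is_complete[OF \<open>finite A\<close> sub this]
  show ?thesis by (simp add: dsa_output_def A_def Let_def)
qed

end
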